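(* Let $\mathcal T=(3^3,4^2)$ be the semi-regular edge-to-edge tessellation of the plane (the elongated triangular tiling) in which every vertex is surrounded, in cyclic order, by three equilateral triangles and two squares. Then its half-domination density satisfies $$\rho_{(3^3,4^2)}\le \frac{13}{21}.$$
   Context: The tessellation $\mathcal T=(3^3,4^2)$ consists of horizontal rows of unit squares alternating with horizontal rows of unit equilateral triangles, all tiles being edge-to-edge; it is periodic: a minimal cluster consisting of one square and two equilateral triangles, translated by all integer combinations of two vectors $v_1,v_2$, tiles the plane. For $m,n\in\mathbb N$, let $G_{\mathcal T,m,n}$ be the graph whose vertices are the tiles of the region formed by $m$ copies of the minimal cluster in the direction $v_1$ and $n$ copies in the direction $v_2$ (i.e. translates by $a v_1+b v_2$, $0\le a<m$, $0\le b<n$), two tiles being adjacent iff they share a common edge. For a vertex $v$ let $d(v)$ be its degree. A set $S$ of vertices is half-dependent if every $v\in S$ has at most $\lfloor d(v)/2\rfloor$ neighbors in $S$. Let $\rho_{\mathcal T,m,n}$ be the maximum cardinality of a half-dependent set in $G_{\mathcal T,m,n}$ divided by the number of vertices of $G_{\mathcal T,m,n}$, and define the half-domination density $\rho_{\mathcal T}=\limsup_{m,n\to\infty}\rho_{\mathcal T,m,n}$. *)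

theory Defs
  imports "HOL-Analysis.Analysis"
begin

definition share_edge :: "'a::euclidean_space set \<Rightarrow> 'a set \<Rightarrow> bool" where
  "share_edge P Q \<longleftrightarrow> P \<noteq> Q \<and> (\<exists>e. e edge_of P \<and> e edge_of Q)"

definition degree_in :: "('v \<Rightarrow> 'v \<Rightarrow> bool) \<Rightarrow> 'v set \<Rightarrow> 'v \<Rightarrow> nat" where
  "degree_in adj V v = card {w \<in> V. adj v w}"

definition half_dependent :: "('v \<Rightarrow> 'v \<Rightarrow> bool) \<Rightarrow> 'v set \<Rightarrow> 'v set \<Rightarrow> bool" where
  "half_dependent adj V S \<longleftrightarrow>
     S \<subseteq> V \<and> (\<forall>v\<in>S. card {w \<in> S. adj v w} \<le> degree_in adj V v div 2)"

definition cluster_region ::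
    "'a::euclidean_space set set \<Rightarrow> 'a \<Rightarrow> 'a \<Rightarrow> nat \<Rightarrow> nat \<Rightarrow> 'a set set" where
  "cluster_region C v1 v2 m n =
     {(\<lambda>x. x + (real a *\<^sub>R v1 + real b *\<^sub>R v2)) ` P | P a b. P \<in> C \<and> a < m \<and> b < n}"

definition half_dep_ratio ::
    "'a::euclidean_space set set \<Rightarrow> 'a \<Rightarrow> 'a \<Rightarrow> nat \<Rightarrow> nat \<Rightarrow> real" where
  "half_dep_ratio C v1 v2 m n =
     real (Max (card ` {S. half_dependent share_edge (cluster_region C v1 v2 m n) S}))
       / real (card (cluster_region C v1 v2 m n))"

definition half_domination_density ::
    "'a::euclidean_space set set \<Rightarrow> 'a \<Rightarrow> 'a \<Rightarrow> ereal" where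
  "half_domination_density C v1 v2 =
     Limsup (sequentially \<times>\<^sub>F sequentially) (\<lambda>(m, n). ereal (half_dep_ratio C v1 v2 m n))"

text \<open>
  The tiling $(3^3,4^2)$: a unit square, the unit equilateral triangle standing on its top side,
  and the inverted triangle to the right of that one.  Translation by \<open>et_v1\<close> fills a row of squares
  and the row of triangles above it; \<open>et_v2\<close> moves the square on to the top side of the inverted
  triangle.
\<close>

definition et_square :: "(real \<times> real) set" where
  "et_square = convex hull {(0, 0), (1, 0), (1, 1), (0, 1)}"

definition et_up :: "(real \<times> real) set" where
  "et_up = convex hull {(0, 1), (1, 1), (1/2, 1 + sqrt 3 / 2)}"

definition et_down :: "(real \<times> real) set" where
  "et_down = convex hull {(1, 1), (3/2, 1 + sqrt 3 / 2), (1/2, 1 + sqrt 3 / 2)}"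

definition et_cluster :: "(real \<times> real) set set" where
  "et_cluster = {et_square, et_up, et_down}"

definition et_v1 :: "real \<times> real" where
  "et_v1 = (1, 0)"

definition et_v2 :: "real \<times> real" where
  "et_v2 = (1/2, 1 + sqrt 3 / 2)"

end

theory Submission
  imports Defs
begin

text \<open>
  Let \<open>N\<close> be the number of clusters, \<open>X\<close> and \<open>Q\<close> the numbers of triangles and squares in a
  half-dependent set, and \<open>E\<close> the number of square-triangle adjacencies inside it.  For a 0/1 labelling
  \<open>x y \<ge> x + y - 1\<close> on every adjacency, so (up to boundary terms) the set contains at least \<open>2 X - 2 N\<close>
  triangle-triangle and \<open>2 Q - N\<close> square-square adjacencies, and \<open>E \<ge> X + 2 Q - 2 N\<close>.  Summing the
  half-dependence conditions over its triangles (at most one neighbour) and squares (at most two) gives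
  \<open>3 X + E \<le> 4 N\<close> and \<open>2 Q + E \<le> 2 N\<close>.  Eliminating \<open>E\<close> leaves \<open>4 X + 2 Q \<le> 6 N\<close> and
  \<open>X + 4 Q \<le> 4 N\<close>; three times the first plus twice the second is \<open>14 (X + Q) \<le> 26 N\<close>, against
  \<open>3 N\<close> tiles.
\<close>

section \<open>Counting inequalities for 0/1 labels on the integer lattice\<close>

text \<open>The range of summation pads the support box by one cell on every side, so the support
  moved by at most one step in each direction is still covered. This margin replaces explicit
  boundary terms.\<close>

lemma sum_shift:
  fixes g :: "int \<Rightarrow> int \<Rightarrow> int"
  assumes supp: "\<And>a b. g a b \<noteq> 0 \<Longrightarrow> 0 \<le> a \<and> a < M \<and> 0 \<le> b \<and> b < N"
    and "\<bar>i\<bar> \<le> 1" "\<bar>j\<bar> \<le> 1"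
  shows "(\<Sum>(a, b)\<in>{-1..M} \<times> {-1..N}. g (a + i) (b + j)) = (\<Sum>(a, b)\<in>{-1..M} \<times> {-1..N}. g a b)"
proof -
  let ?B = "{0..<M} \<times> {0..<N}"
  let ?s = "\<lambda>(a, b). (a - i, b - j)"
  have "(\<Sum>(a, b)\<in>{-1..M} \<times> {-1..N}. g (a + i) (b + j)) = (\<Sum>(a, b)\<in>?s ` ?B. g (a + i) (b + j))"
  proof (rule sum.mono_neutral_right)
    show "\<forall>p\<in>{-1..M} \<times> {-1..N} - ?s ` ?B. (case p of (a, b) \<Rightarrow> g (a + i) (b + j)) = 0"
    proof clarify
      fix a b assume "(a, b) \<notin> ?s ` ?B"
      show "g (a + i) (b + j) = 0"
      proof (rule ccontr)
        assume "g (a + i) (b + j) \<noteq> 0"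
        then have "(a + i, b + j) \<in> ?B" using supp by auto
        then have "(a, b) \<in> ?s ` ?B" by (force simp: image_iff)
        then show False using \<open>(a, b) \<notin> ?s ` ?B\<close> by blast
      qed
    qed
  qed (use assms(2,3) in auto)
  also have "\<dots> = (\<Sum>(a, b)\<in>?B. g a b)"
    by (subst sum.reindex) (auto simp: inj_on_def case_prod_unfold)
  also have "\<dots> = (\<Sum>(a, b)\<in>{-1..M} \<times> {-1..N}. g a b)"
    using supp by (intro sum.mono_neutral_left) force+
  finally show ?thesis .
qed

text \<open>Here \<open>q\<close>, \<open>u\<close>, \<open>d\<close> stand for the indicators of
  chosen squares, upward and downward triangles, and the last three hypotheses are the
  half-dependence conditions at interior tiles.\<close>

lemma weighted_count_bound:
  fixes q u d :: "int \<Rightarrow> int \<Rightarrow> int" and M N :: int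
  assumes q01: "\<And>a b. q a b \<in> {0, 1}" and u01: "\<And>a b. u a b \<in> {0, 1}"
    and d01: "\<And>a b. d a b \<in> {0, 1}"
    and q_supp: "\<And>a b. q a b \<noteq> 0 \<Longrightarrow> 0 \<le> a \<and> a < M \<and> 0 \<le> b \<and> b < N"
    and u_supp: "\<And>a b. u a b \<noteq> 0 \<Longrightarrow> 0 \<le> a \<and> a < M \<and> 0 \<le> b \<and> b < N"
    and d_supp: "\<And>a b. d a b \<noteq> 0 \<Longrightarrow> 0 \<le> a \<and> a < M \<and> 0 \<le> b \<and> b < N"
    and u_deg: "\<And>a b. u a b = 1 \<Longrightarrow> q a b + d (a - 1) b + d a b \<le> 1"
    and d_deg: "\<And>a b. d a b = 1 \<Longrightarrow> q a (b + 1) + u a b + u (a + 1) b \<le> 1"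
    and q_deg: "\<And>a b. q a b = 1 \<Longrightarrow> q (a - 1) b + q (a + 1) b + u a b + d a (b - 1) \<le> 2"
  shows "14 * (\<Sum>(a, b)\<in>{-1..M} \<times> {-1..N}. q a b + u a b + d a b)
           \<le> 26 * int (card ({-1..M} \<times> {-1..N}))"
proof -
  define W where "W = {-1..M} \<times> {-1..N}"
  define T where "T f = (\<Sum>(a, b)\<in>W. f a b)" for f :: "int \<Rightarrow> int \<Rightarrow> int"
  define K where "K = int (card W)"
  have T_add: "T (\<lambda>a b. f a b + g a b) = T f + T g" for f g
    by (simp add: T_def case_prod_unfold sum.distrib)
  have T_mono: "T f \<le> T g" if "\<And>a b. f a b \<le> g a b" for f g
    unfolding T_def using that by (intro sum_mono) auto
  have T_1: "T (\<lambda>a b. 1) = K"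
    by (simp add: T_def K_def case_prod_unfold)
  have shift: "T (\<lambda>a b. g (a + i) (b + j)) = T g"
    if "\<And>a b. g a b \<noteq> 0 \<Longrightarrow> 0 \<le> a \<and> a < M \<and> 0 \<le> b \<and> b < N" "\<bar>i\<bar> \<le> 1" "\<bar>j\<bar> \<le> 1" for g i j
    unfolding T_def W_def using sum_shift[of g M N i j] that by blast
  define ud where "ud = T (\<lambda>a b. u a b * d a b)"
  define ud' where "ud' = T (\<lambda>a b. u (a + 1) b * d a b)"
  define qu where "qu = T (\<lambda>a b. q a b * u a b)"
  define qd where "qd = T (\<lambda>a b. q a (b + 1) * d a b)"
  define qq where "qq = T (\<lambda>a b. q a b * q (a + 1) b)"
  \<comment> \<open>Each adjacency is seen from both of its tiles, in different coordinates;
    shifting identifies the two counts. The product inherits bounded support from one of its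
    factors.\<close>
  have ud'_shift: "T (\<lambda>a b. u a b * d (a - 1) b) = ud'"
    unfolding ud'_def using shift[of "\<lambda>a b. u (a + 1) b * d a b" "-1" 0] d_supp by force
  have qd_shift: "T (\<lambda>a b. q a b * d a (b - 1)) = qd"
    unfolding qd_def using shift[of "\<lambda>a b. q a (b + 1) * d a b" 0 "-1"] d_supp by force
  have qq_shift: "T (\<lambda>a b. q (a - 1) b * q a b) = qq"
    unfolding qq_def using shift[of "\<lambda>a b. q a b * q (a + 1) b" "-1" 0] q_supp by force
  have u_shift: "T (\<lambda>a b. u (a + 1) b) = T u" and q_shift: "T (\<lambda>a b. q (a + 1) b) = T q"
    and q_shift': "T (\<lambda>a b. q a (b + 1)) = T q"
    using shift[of u 1 0] shift[of q 1 0] shift[of q 0 1] u_supp q_supp by simp_all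

  \<comment> \<open>Multiplying a degree condition by the label of its own tile makes it valid at
    every cell: both sides vanish where the label is 0.\<close>
  have "T (\<lambda>a b. q a b * u a b + u a b * d (a - 1) b + u a b * d a b) \<le> T u"
  proof (rule T_mono, goal_cases)
    case (1 a b)
    then show ?case using u_deg[of a b] u01[of a b] by auto
  qed
  then have U: "qu + ud' + ud \<le> T u"
    by (simp add: T_add ud'_shift ud_def qu_def)
  have "T (\<lambda>a b. q a (b + 1) * d a b + u a b * d a b + u (a + 1) b * d a b) \<le> T d"
  proof (rule T_mono, goal_cases)
    case (1 a b)
    then show ?case using d_deg[of a b] d01[of a b] by auto
  qed
  then have D: "qd + ud + ud' \<le> T d"
    by (simp add: T_add ud'_def ud_def qd_def)
  have "T (\<lambda>a b. q (a - 1) b * q a b + q a b * q (a + 1) b + q a b * u a b + q a b * d a (b - 1))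
      \<le> T (\<lambda>a b. q a b + q a b)"
  proof (rule T_mono, goal_cases)
    case (1 a b)
    then show ?case using q_deg[of a b] q01[of a b] by auto
  qed
  then have Q: "2 * qq + qu + qd \<le> 2 * T q"
    using T_add[of q q] by (simp add: T_add qq_shift qd_shift qq_def[symmetric] qu_def)

  have edge: "x + y \<le> x * y + 1" if "x \<in> {0, 1}" "y \<in> {0, 1}" for x y :: int
    using that by auto
  \<comment> \<open>One inequality for each of the five translation classes of adjacencies.\<close>
  have "T (\<lambda>a b. u a b + d a b) \<le> T (\<lambda>a b. u a b * d a b + 1)"
    "T (\<lambda>a b. u (a + 1) b + d a b) \<le> T (\<lambda>a b. u (a + 1) b * d a b + 1)"
    "T (\<lambda>a b. q a b + q (a + 1) b) \<le> T (\<lambda>a b. q a b * q (a + 1) b + 1)"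
    "T (\<lambda>a b. q a b + u a b) \<le> T (\<lambda>a b. q a b * u a b + 1)"
    "T (\<lambda>a b. q a (b + 1) + d a b) \<le> T (\<lambda>a b. q a (b + 1) * d a b + 1)"
    by (intro T_mono edge q01 u01 d01)+
  then have "T u + T d \<le> ud + K" "T u + T d \<le> ud' + K" "2 * T q \<le> qq + K"
    "T q + T u \<le> qu + K" "T q + T d \<le> qd + K"
    by (simp_all add: T_add T_1 u_shift q_shift q_shift' ud_def ud'_def qq_def qu_def qd_def)
  with U D Q have "14 * T q + 14 * T u + 14 * T d \<le> 26 * K"
    by linarith
  then show ?thesis
    unfolding T_def K_def W_def by (simp add: case_prod_unfold sum.distrib)
qed

section \<open>Integer labels for the vertices, sides and tiles\<close>

datatype shape = Square | Up | Down

text \<open>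
  The vertex \<open>(a, b, k)\<close> is the lattice point \<open>a v\<^sub>1 + b v\<^sub>2\<close>, moved up by a unit when \<open>k\<close> holds:
  the lattice points are the lower corners of the squares, their translates the upper corners.
\<close>

definition vertex_pos :: "int \<times> int \<times> bool \<Rightarrow> real \<times> real" where
  "vertex_pos = (\<lambda>(a, b, k). (of_int a + of_int b / 2, of_int b * (1 + sqrt 3 / 2) + of_bool k))"

fun vertices :: "shape \<times> int \<times> int \<Rightarrow> (int \<times> int \<times> bool) set" where
  "vertices (Square, a, b) = {(a, b, False), (a + 1, b, False), (a + 1, b, True), (a, b, True)}"
| "vertices (Up, a, b) = {(a, b, True), (a + 1, b, True), (a, b + 1, False)}"
| "vertices (Down, a, b) = {(a + 1, b, True), (a + 1, b + 1, False), (a, b + 1, False)}"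

text \<open>Sides are unordered pairs of global vertex labels, so a side common to two tiles is
  literally the same set for both.\<close>

fun sides :: "shape \<times> int \<times> int \<Rightarrow> (int \<times> int \<times> bool) set set" where
  "sides (Square, a, b) = {{(a, b, False), (a + 1, b, False)}, {(a + 1, b, False), (a + 1, b, True)},
     {(a, b, True), (a + 1, b, True)}, {(a, b, False), (a, b, True)}}"
| "sides (Up, a, b) = {{(a, b, True), (a + 1, b, True)}, {(a + 1, b, True), (a, b + 1, False)},
     {(a, b, True), (a, b + 1, False)}}"
| "sides (Down, a, b) = {{(a + 1, b, True), (a + 1, b + 1, False)},
     {(a, b + 1, False), (a + 1, b + 1, False)}, {(a + 1, b, True), (a, b + 1, False)}}"

fun neighbours :: "shape \<times> int \<times> int \<Rightarrow> (shape \<times> int \<times> int) set" where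
  "neighbours (Square, a, b) = {(Square, a - 1, b), (Square, a + 1, b), (Up, a, b), (Down, a, b - 1)}"
| "neighbours (Up, a, b) = {(Square, a, b), (Down, a - 1, b), (Down, a, b)}"
| "neighbours (Down, a, b) = {(Square, a, b + 1), (Up, a, b), (Up, a + 1, b)}"

definition tile :: "shape \<times> int \<times> int \<Rightarrow> (real \<times> real) set" where
  "tile t = convex hull (vertex_pos ` vertices t)"

text \<open>Consecutive values of \<open>b\<close> differ in height by
  \<open>1 + sqrt 3 / 2 > 1\<close>, while \<open>k\<close> changes the height by at most 1. Hence
  the height determines \<open>b\<close> and \<open>k\<close>, and the first coordinate then
  determines \<open>a\<close>.\<close>

lemma inj_vertex_pos: "inj vertex_pos"
proof (rule injI, unfold split_paired_all)
  fix a b k a' b' k' assume "vertex_pos (a, b, k) = vertex_pos (a', b', k')"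
  then have x: "of_int a + of_int b / 2 = (of_int a' + of_int b' / 2 :: real)"
    and y: "of_int b * (1 + sqrt 3 / 2) + of_bool k = of_int b' * (1 + sqrt 3 / 2) + (of_bool k' :: real)"
    by (auto simp: vertex_pos_def)
  have "b = b'"
  proof (rule ccontr)
    assume "b \<noteq> b'"
    then have "1 \<le> \<bar>of_int (b - b')\<bar> * (1 :: real)"
      by (simp flip: of_int_diff of_int_abs)
    also have "\<dots> < \<bar>of_int (b - b')\<bar> * (1 + sqrt 3 / 2)"
      using \<open>b \<noteq> b'\<close> by (intro mult_strict_left_mono) auto
    also have "\<dots> = \<bar>of_int (b - b') * (1 + sqrt 3 / 2)\<bar>"
      by (simp add: abs_mult)
    also have "of_int (b - b') * (1 + sqrt 3 / 2) = of_bool k' - of_bool k"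
      using y unfolding of_int_diff left_diff_distrib by linarith
    also have "\<bar>of_bool k' - of_bool k\<bar> \<le> (1 :: real)" by simp
    finally show False by simp
  qed
  with x y show "(a, b, k) = (a', b', k')" by (auto simp: of_bool_def split: if_splits)
qed

lemma finite_vertices: "finite (vertices t)"
  by (cases t rule: vertices.cases) auto

section \<open>Edges and extreme points of the tiles\<close>

text \<open>The hyperplane through \<open>p\<close> with normal \<open>c\<close> contains the affine
  hull of \<open>T\<close>, and the hull of the other points lies strictly on one side of it; this
  disjointness is what makes the hull of \<open>T\<close> a face.\<close>

lemma convex_hull_face_of_convex_hull:
  fixes S T :: "'a::euclidean_space set"
  assumes "finite S" "T \<subseteq> S" "\<And>x. x \<in> T \<Longrightarrow> c \<bullet> (x - p) = 0"
    and "\<And>x. x \<in> S - T \<Longrightarrow> c \<bullet> (x - p) < 0"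
  shows "convex hull T face_of convex hull S"
proof (rule face_of_convex_hulls)
  have "affine hull T \<subseteq> {x. c \<bullet> x = c \<bullet> p}"
    by (rule hull_minimal) (use assms(3) in \<open>auto simp: affine_hyperplane inner_diff_right\<close>)
  moreover have "convex hull (S - T) \<subseteq> {x. c \<bullet> x < c \<bullet> p}"
    by (rule hull_minimal) (use assms(4) in \<open>auto simp: convex_halfspace_lt inner_diff_right\<close>)
  ultimately show "affine hull T \<inter> convex hull (S - T) = {}" by fastforce
qed (use assms in auto)

lemma edge_of_tileI:
  assumes "\<forall>x\<in>vertices t - {v, w}. c \<bullet> (vertex_pos x - vertex_pos v) < 0"
    and "c \<bullet> (vertex_pos w - vertex_pos v) = 0" "v \<in> vertices t" "w \<in> vertices t" "v \<noteq> w"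
  shows "(convex hull (vertex_pos ` {v, w})) edge_of tile t"
proof -
  have "convex hull (vertex_pos ` {v, w}) face_of tile t"
    unfolding tile_def
    by (rule convex_hull_face_of_convex_hull[of _ _ c "vertex_pos v"])
      (use assms finite_vertices in \<open>auto simp del: split_paired_All\<close>)
  moreover have "vertex_pos v \<noteq> vertex_pos w"
    using inj_vertex_pos assms by (simp add: inj_eq)
  ultimately show ?thesis
    by (simp add: edge_of_def aff_dim_convex_hull)
qed

lemma side_edge_of_tile:
  assumes "s \<in> sides t"
  shows "(convex hull (vertex_pos ` s)) edge_of tile t"
proof (cases t rule: vertices.cases)
  case (1 a b)
  \<comment> \<open>In all three cases \<open>c\<close> is an outward normal of the side, scaled to
    length 2 for the slanted sides of triangles.\<close>
  have "(convex hull (vertex_pos ` {(a, b, False), (a + 1, b, False)})) edge_of tile t"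
    by (rule edge_of_tileI[where c = "(0, -1)"]) (auto simp: 1 vertex_pos_def field_simps)
  moreover have "(convex hull (vertex_pos ` {(a + 1, b, False), (a + 1, b, True)})) edge_of tile t"
    by (rule edge_of_tileI[where c = "(1, 0)"]) (auto simp: 1 vertex_pos_def field_simps)
  moreover have "(convex hull (vertex_pos ` {(a, b, True), (a + 1, b, True)})) edge_of tile t"
    by (rule edge_of_tileI[where c = "(0, 1)"]) (auto simp: 1 vertex_pos_def field_simps)
  moreover have "(convex hull (vertex_pos ` {(a, b, False), (a, b, True)})) edge_of tile t"
    by (rule edge_of_tileI[where c = "(-1, 0)"]) (auto simp: 1 vertex_pos_def field_simps)
  ultimately show ?thesis
    using assms by (auto simp: 1)
next
  case (2 a b)
  have "(convex hull (vertex_pos ` {(a, b, True), (a + 1, b, True)})) edge_of tile t"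
    by (rule edge_of_tileI[where c = "(0, -1)"]) (auto simp: 2 vertex_pos_def field_simps)
  moreover have "(convex hull (vertex_pos ` {(a + 1, b, True), (a, b + 1, False)})) edge_of tile t"
    by (rule edge_of_tileI[where c = "(sqrt 3, 1)"]) (auto simp: 2 vertex_pos_def field_simps)
  moreover have "(convex hull (vertex_pos ` {(a, b, True), (a, b + 1, False)})) edge_of tile t"
    by (rule edge_of_tileI[where c = "(- sqrt 3, 1)"]) (auto simp: 2 vertex_pos_def field_simps)
  ultimately show ?thesis
    using assms by (auto simp: 2)
next
  case (3 a b)
  have "(convex hull (vertex_pos ` {(a + 1, b, True), (a + 1, b + 1, False)})) edge_of tile t"
    by (rule edge_of_tileI[where c = "(sqrt 3, -1)"]) (auto simp: 3 vertex_pos_def field_simps)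
  moreover have "(convex hull (vertex_pos ` {(a, b + 1, False), (a + 1, b + 1, False)})) edge_of tile t"
    by (rule edge_of_tileI[where c = "(0, 1)"]) (auto simp: 3 vertex_pos_def field_simps)
  moreover have "(convex hull (vertex_pos ` {(a + 1, b, True), (a, b + 1, False)})) edge_of tile t"
    by (rule edge_of_tileI[where c = "(- sqrt 3, -1)"]) (auto simp: 3 vertex_pos_def field_simps)
  ultimately show ?thesis
    using assms by (auto simp: 3)
qed

text \<open>Every vertex is an endpoint of some side, hence extreme in it, and an extreme point of a
  face is extreme in the whole tile.\<close>

lemma extreme_points_tile: "{x. x extreme_point_of tile t} = vertex_pos ` vertices t"
proof
  show "{x. x extreme_point_of tile t} \<subseteq> vertex_pos ` vertices t"
    using extreme_point_of_convex_hull unfolding tile_def by blast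
  have "vertex_pos v extreme_point_of tile t" if "{v, w} \<in> sides t" for v w
  proof -
    have "convex hull {vertex_pos v, vertex_pos w} face_of tile t"
      using side_edge_of_tile[OF that] by (simp add: edge_of_def)
    from extreme_point_of_face[OF this, of "vertex_pos v"] show ?thesis
      by (simp add: extreme_point_of_convex_hull_2)
  qed
  moreover have "\<exists>w. {v, w} \<in> sides t" if "v \<in> vertices t" for v
    using that by (cases t rule: vertices.cases) (auto simp: doubleton_eq_iff)
  ultimately show "vertex_pos ` vertices t \<subseteq> {x. x extreme_point_of tile t}"
    by blast
qed

text \<open>A point set determines its extreme points, and the corner labels determine shape and
  position. Tiles can therefore be counted through their labels.\<close>

lemma inj_tile: "inj tile"
proof (rule injI)
  fix t t' assume "tile t = tile t'"
  then have "vertices t \<subseteq> vertices t'"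
    using extreme_points_tile inj_image_eq_iff[OF inj_vertex_pos] by (metis order_refl)
  then show "t = t'"
    by (cases t rule: vertices.cases; cases t' rule: vertices.cases) auto
qed

text \<open>A shared edge is the hull of its extreme points, which are vertices of both tiles.\<close>

lemma share_edge_two_common_vertices:
  assumes "share_edge (tile t) (tile t')"
  obtains v w where "v \<noteq> w" "v \<in> vertices t \<inter> vertices t'" "w \<in> vertices t \<inter> vertices t'"
proof -
  obtain e where e: "e edge_of tile t" "e edge_of tile t'"
    using assms by (auto simp: share_edge_def)
  let ?X = "{x. x extreme_point_of e}"
  have "compact (tile t)" "convex (tile t)"
    by (auto simp: tile_def finite_vertices finite_imp_compact compact_convex_hull)
  then have "e = convex hull ?X"
    using e by (intro Krein_Milman_Minkowski)
      (auto simp: edge_of_def intro: face_of_imp_compact face_of_imp_convex)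
  then have "aff_dim ?X = 1"
    using e by (metis aff_dim_convex_hull edge_of_def)
  \<comment> \<open>A set with at most one point has affine dimension at most 0, so an edge has two
    distinct extreme points.\<close>
  then have not_single: "\<not> ?X \<subseteq> {x}" for x
    using aff_dim_subset[of ?X "{x}"] by auto
  obtain x where "x \<in> ?X" using not_single[of 0] by auto
  obtain y where "y \<in> ?X" "y \<noteq> x" using not_single[of x] by auto
  have common: "z \<in> vertex_pos ` (vertices t \<inter> vertices t')" if "z \<in> ?X" for z
  proof -
    have "z extreme_point_of tile t" "z extreme_point_of tile t'"
      using that e extreme_point_of_face[of e "tile t" z] extreme_point_of_face[of e "tile t'" z]
      by (auto simp: edge_of_def)
    then show ?thesis
      using extreme_points_tile[of t] extreme_points_tile[of t'] image_Int[OF inj_vertex_pos] by auto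
  qed
  obtain v w where "x = vertex_pos v" "v \<in> vertices t \<inter> vertices t'"
    "y = vertex_pos w" "w \<in> vertices t \<inter> vertices t'"
    using common[OF \<open>x \<in> ?X\<close>] common[OF \<open>y \<in> ?X\<close>] by (elim imageE)
  then show ?thesis using that \<open>y \<noteq> x\<close> by metis
qed

text \<open>No second tile contains both ends of a diagonal of a square, so two common corners
  always span a common side; a check over pairs of shapes confirms this.\<close>

lemma two_common_vertices_neighbours:
  assumes "v \<noteq> w" "v \<in> vertices t" "v \<in> vertices t'" "w \<in> vertices t" "w \<in> vertices t'" "t \<noteq> t'"
  shows "t' \<in> neighbours t"
  using assms
  by (cases t rule: vertices.cases; cases t' rule: vertices.cases;
      simp only: vertices.simps insert_iff empty_iff; elim disjE; simp)

lemma neighbours_common_side: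
  assumes "t' \<in> neighbours t"
  shows "t \<noteq> t'" "sides t \<inter> sides t' \<noteq> {}"
  using assms by (cases t rule: vertices.cases; simp; elim disjE; simp)+

text \<open>This reduces geometric adjacency to arithmetic on labels. One direction uses two common
  corners of the shared edge, the other realises a common side as an edge of both tiles.\<close>

lemma share_edge_tile_iff: "share_edge (tile t) (tile t') \<longleftrightarrow> t' \<in> neighbours t"
proof
  assume shared: "share_edge (tile t) (tile t')"
  then obtain v w where "v \<noteq> w" "v \<in> vertices t \<inter> vertices t'" "w \<in> vertices t \<inter> vertices t'"
    by (rule share_edge_two_common_vertices)
  moreover have "t \<noteq> t'" using shared by (auto simp: share_edge_def)
  ultimately show "t' \<in> neighbours t"
    using two_common_vertices_neighbours[of v w t t'] by simp
next
  assume n: "t' \<in> neighbours t"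
  from neighbours_common_side(2)[OF n] obtain s where "s \<in> sides t" "s \<in> sides t'"
    by (meson disjoint_iff)
  then show "share_edge (tile t) (tile t')"
    using side_edge_of_tile neighbours_common_side(1)[OF n]
    unfolding share_edge_def inj_eq[OF inj_tile] by meson
qed

section \<open>The finite region and its half-dependent sets\<close>

lemma UNIV_shape: "(UNIV :: shape set) = {Square, Up, Down}"
  using shape.exhaust by blast

lemma tile_translate:
  "(\<lambda>x. x + (real a *\<^sub>R et_v1 + real b *\<^sub>R et_v2)) ` tile (s, 0, 0) = tile (s, int a, int b)"
proof -
  define v where "v = real a *\<^sub>R et_v1 + real b *\<^sub>R et_v2"
  have shift: "vertex_pos (i, j, k) + v = vertex_pos (int a + i, int b + j, k)" for i j k
    by (simp add: v_def vertex_pos_def et_v1_def et_v2_def algebra_simps add_divide_distrib)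
  have "(\<lambda>x. x + v) ` tile (s, 0, 0) = convex hull ((\<lambda>x. x + v) ` vertex_pos ` vertices (s, 0, 0))"
    unfolding tile_def by (simp only: convex_hull_translation add.commute[of _ v])
  also have "\<dots> = tile (s, int a, int b)"
    by (cases s) (simp_all add: tile_def shift)
  finally show ?thesis
    by (simp only: v_def)
qed

lemma cluster_region_et:
  "cluster_region et_cluster et_v1 et_v2 m n = tile ` (UNIV \<times> {0..<int m} \<times> {0..<int n})"
proof -
  have "et_cluster = {tile (Square, 0, 0), tile (Up, 0, 0), tile (Down, 0, 0)}"
    by (simp add: et_cluster_def et_square_def et_up_def et_down_def tile_def vertex_pos_def)
  then have cluster: "et_cluster = (\<lambda>s. tile (s, 0, 0)) ` UNIV"
    by (simp add: UNIV_shape)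
  have "cluster_region et_cluster et_v1 et_v2 m n
      = {tile (s, int a, int b) | s a b. a < m \<and> b < n}"
    unfolding cluster_region_def cluster tile_translate[symmetric] by blast
  also have "\<dots> = tile ` (UNIV \<times> int ` {0..<m} \<times> int ` {0..<n})"
    by (auto simp: image_iff) blast
  finally show ?thesis
    by (simp add: image_int_atLeastLessThan)
qed

text \<open>
  Passing to the unbounded tiling only weakens the degree condition, so the boundary of the region
  needs no separate treatment.
\<close>

lemma half_dependent_tiles_bound:
  assumes S: "half_dependent share_edge (tile ` I) S" and "finite I" "t \<in> I" "tile t \<in> S"
  shows "card {t' \<in> neighbours t. tile t' \<in> S} \<le> card (neighbours t) div 2"
proof -
  have fin: "finite (neighbours t)" by (cases t rule: neighbours.cases) auto
  have "tile ` {t' \<in> neighbours t. tile t' \<in> S} \<subseteq> {w \<in> S. share_edge (tile t) w}"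
    by (auto simp: share_edge_tile_iff)
  moreover have "finite S"
    using S \<open>finite I\<close> finite_subset unfolding half_dependent_def by blast
  ultimately have "card (tile ` {t' \<in> neighbours t. tile t' \<in> S}) \<le> card {w \<in> S. share_edge (tile t) w}"
    by (intro card_mono) auto
  then have "card {t' \<in> neighbours t. tile t' \<in> S} \<le> card {w \<in> S. share_edge (tile t) w}"
    by (simp add: card_image inj_on_subset[OF inj_tile])
  also have "\<dots> \<le> degree_in share_edge (tile ` I) (tile t) div 2"
    using S \<open>tile t \<in> S\<close> unfolding half_dependent_def by blast
  also have "degree_in share_edge (tile ` I) (tile t) \<le> card (neighbours t)"
  proof -
    have "{w \<in> tile ` I. share_edge (tile t) w} \<subseteq> tile ` neighbours t"
      by (auto simp: share_edge_tile_iff)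
    then show ?thesis
      unfolding degree_in_def using fin by (meson card_mono card_image_le finite_imageI le_trans)
  qed
  finally show ?thesis by (simp add: div_le_mono)
qed

text \<open>The factors \<open>m + 2\<close> and \<open>n + 2\<close> are the side lengths of the
  padded box in the counting inequality.\<close>

lemma card_half_dependent_le:
  assumes S: "half_dependent share_edge (cluster_region et_cluster et_v1 et_v2 m n) S"
  shows "14 * card S \<le> 26 * ((m + 2) * (n + 2))"
proof -
  define I where "I = (UNIV :: shape set) \<times> {0..<int m} \<times> {0..<int n}"
  define W where "W = {-1..int m} \<times> {-1..int n}"
  define f where "f s a b = (of_bool (tile (s, a, b) \<in> S) :: int)" for s a b
  have mem: "tile (s, a, b) \<in> S \<longleftrightarrow> f s a b = 1" for s a b by (simp add: f_def)
  have finI: "finite I" by (simp add: I_def UNIV_shape)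
  have S': "half_dependent share_edge (tile ` I) S"
    using S by (simp add: cluster_region_et I_def)
  have "S \<subseteq> tile ` I" using S' by (simp add: half_dependent_def)
  then have supp: "(s, a, b) \<in> I" if "tile (s, a, b) \<in> S" for s a b
    using that inj_tile by (auto simp: inj_eq)
  have count: "int (card {t' \<in> A. tile t' \<in> S}) = (\<Sum>(s, a, b)\<in>A. f s a b)" if "finite A" for A
    using that by (simp add: f_def case_prod_unfold Int_def flip: sum.inter_filter)
  have deg: "(\<Sum>(s, a, b)\<in>neighbours t. f s a b) \<le> int (card (neighbours t) div 2)"
    if "tile t \<in> S" for t
  proof -
    have "finite (neighbours t)" by (cases t rule: neighbours.cases) auto
    moreover have "t \<in> I" using supp that by (cases t) auto
    ultimately show ?thesis
      using half_dependent_tiles_bound[OF S' finI _ that] count[of "neighbours t"] by simp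
  qed
  have "14 * (\<Sum>(a, b)\<in>W. f Square a b + f Up a b + f Down a b) \<le> 26 * int (card W)"
    unfolding W_def
  \<comment> \<open>Triangles have 3 neighbours and squares 4 in the unbounded tiling, so the halved
    degrees are 1 and 2.\<close>
  proof (rule weighted_count_bound)
    fix a b
    show "f Up a b = 1 \<Longrightarrow> f Square a b + f Down (a - 1) b + f Down a b \<le> 1"
      using deg[of "(Up, a, b)"] by (simp add: mem)
    show "f Down a b = 1 \<Longrightarrow> f Square a (b + 1) + f Up a b + f Up (a + 1) b \<le> 1"
      using deg[of "(Down, a, b)"] by (simp add: mem)
    show "f Square a b = 1 \<Longrightarrow> f Square (a - 1) b + f Square (a + 1) b + f Up a b + f Down a (b - 1) \<le> 2"
      using deg[of "(Square, a, b)"] by (simp add: mem)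
  qed (use supp in \<open>auto simp: f_def I_def\<close>)
  moreover have "int (card S) = (\<Sum>(a, b)\<in>W. f Square a b + f Up a b + f Down a b)"
  proof -
    have "(\<Sum>(a, b)\<in>W. f Square a b + f Up a b + f Down a b) = (\<Sum>(a, b)\<in>W. \<Sum>s\<in>UNIV. f s a b)"
      by (simp add: UNIV_shape add.assoc)
    also have "\<dots> = (\<Sum>(s, a, b)\<in>UNIV \<times> W. f s a b)"
      unfolding case_prod_unfold by (subst sum.swap) (simp add: sum.cartesian_product case_prod_unfold)
    also have "\<dots> = int (card {t \<in> UNIV \<times> W. tile t \<in> S})"
      by (rule count[symmetric]) (simp add: W_def UNIV_shape)
    also have "card {t \<in> UNIV \<times> W. tile t \<in> S} = card (tile ` {t \<in> UNIV \<times> W. tile t \<in> S})"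
      by (rule card_image[symmetric]) (rule inj_on_subset[OF inj_tile subset_UNIV])
    also have "tile ` {t \<in> UNIV \<times> W. tile t \<in> S} = S"
      using \<open>S \<subseteq> tile ` I\<close> by (force simp: I_def W_def)
    finally show ?thesis ..
  qed
  ultimately have "int (14 * card S) \<le> int (26 * ((m + 2) * (n + 2)))"
    by (simp add: W_def card_cartesian_product nat_add_distrib algebra_simps)
  then show ?thesis by (simp only: of_nat_le_iff)
qed

section \<open>Densities and the limit superior\<close>

text \<open>Dividing the cardinality bound by the \<open>3 * m * n\<close> tiles gives 26/(14 * 3) =
  13/21, and the padding contributes only factors tending to 1.\<close>

lemma half_dep_ratio_le:
  assumes "m > 0" "n > 0"
  shows "half_dep_ratio et_cluster et_v1 et_v2 m n \<le> 13 / 21 * ((1 + 2 / m) * (1 + 2 / n))"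
proof -
  let ?R = "cluster_region et_cluster et_v1 et_v2 m n"
  let ?H = "{S. half_dependent share_edge ?R S}"
  have "card ?R = 3 * m * n"
    unfolding cluster_region_et
    by (subst card_image[OF inj_on_subset[OF inj_tile subset_UNIV]])
      (simp add: card_cartesian_product UNIV_shape)
  have "finite ?R" by (simp add: cluster_region_et UNIV_shape)
  then have "finite ?H"
    by (rule finite_subset[rotated, OF finite_Pow_iff[THEN iffD2]]) (auto simp: half_dependent_def)
  moreover have "{} \<in> ?H" by (simp add: half_dependent_def)
  ultimately have "Max (card ` ?H) \<in> card ` ?H" by (intro Max_in) auto
  then have "14 * Max (card ` ?H) \<le> 26 * ((m + 2) * (n + 2))"
    using card_half_dependent_le by auto
  then have "real (14 * Max (card ` ?H)) \<le> real (26 * ((m + 2) * (n + 2)))"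
    by (simp only: of_nat_le_iff)
  then have "real (Max (card ` ?H)) \<le> 13 / 7 * ((real m + 2) * (real n + 2))"
    by (simp add: algebra_simps)
  then have "half_dep_ratio et_cluster et_v1 et_v2 m n
      \<le> 13 / 7 * ((real m + 2) * (real n + 2)) / (3 * real m * real n)"
    unfolding half_dep_ratio_def \<open>card ?R = 3 * m * n\<close> of_nat_mult of_nat_numeral
    by (rule divide_right_mono) simp
  also have "\<dots> = 13 / 21 * ((1 + 2 / m) * (1 + 2 / n))"
    using assms by (simp add: field_simps)
  finally show ?thesis .
qed

theorem theorem3p1:
  "half_domination_density et_cluster et_v1 et_v2 \<le> ereal (13 / 21)"
proof -
  let ?F = "sequentially \<times>\<^sub>F sequentially"
  define g where "g = (\<lambda>(m, n). 13 / 21 * ((1 + 2 / real m) * (1 + 2 / real n)))"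
  have "((\<lambda>n. 1 + 2 / real n) \<longlongrightarrow> 1 + 0) sequentially"
    by (intro tendsto_add tendsto_const lim_const_over_n)
  then have "((\<lambda>p. 1 + 2 / real (fst p)) \<longlongrightarrow> 1 + 0) ?F" "((\<lambda>p. 1 + 2 / real (snd p)) \<longlongrightarrow> 1 + 0) ?F"
    by (rule filterlim_compose, intro filterlim_fst filterlim_snd)+
  then have "(g \<longlongrightarrow> 13 / 21 * ((1 + 0) * (1 + 0))) ?F"
    unfolding g_def case_prod_unfold by (intro tendsto_mult tendsto_const)
  then have "((\<lambda>p. ereal (g p)) \<longlongrightarrow> ereal (13 / 21)) ?F"
    by simp
  \<comment> \<open>A limit equals the limit superior because the product filter is
    nontrivial.\<close>
  then have lim: "Limsup ?F (\<lambda>p. ereal (g p)) = ereal (13 / 21)"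
    by (intro lim_imp_Limsup) (simp_all add: prod_filter_eq_bot)
  \<comment> \<open>The ratio bound is available for positive \<open>m\<close> and \<open>n\<close>,
    which holds eventually in the product filter.\<close>
  have "\<forall>\<^sub>F p in ?F. (case p of (m, n) \<Rightarrow> ereal (half_dep_ratio et_cluster et_v1 et_v2 m n)) \<le> ereal (g p)"
    using eventually_prodI[OF eventually_gt_at_top[of 0] eventually_gt_at_top[of 0]]
    by eventually_elim (simp only: g_def case_prod_unfold ereal_less_eq half_dep_ratio_le)
  then have "half_domination_density et_cluster et_v1 et_v2 \<le> Limsup ?F (\<lambda>p. ereal (g p))"
    unfolding half_domination_density_def by (rule Limsup_mono)
  then show ?thesis
    unfolding lim .
qed

end
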